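(* Let $M\in\mathbb{C}^{p\times p}$ be nonsingular and let $\mathcal{A},\mathcal{B}\in\mathbb{C}^{m\times m\times p}$ have tubal indices $k_1$ and $k_2$, respectively. If $\mathcal{A}*_M\mathcal{B}=\mathcal{B}*_M\mathcal{A}$, then $$(\mathcal{A}*_M\mathcal{B})^{\mathrm D}=\mathcal{B}^{\mathrm D}*_M\mathcal{A}^{\mathrm D}=\mathcal{A}^{\mathrm D}*_M\mathcal{B}^{\mathrm D}.$$
   Context: Transform: for $\mathcal{A}\in\mathbb{C}^{m\times n\times p}$, $\tilde{\mathcal{A}}=\mathcal{A}\times_3 M\in\mathbb{C}^{m\times n\times p}$ is given by $(\tilde{\mathcal{A}})_{ijk}=\sum_{s=1}^p(\mathcal{A})_{ijs}M_{ks}$, and $\tilde{\mathcal{A}}^{(i)}=\tilde{\mathcal{A}}(:,:,i)$ is its $i$th frontal slice. Since $M$ is nonsingular, $\mathcal{A}\mapsto\tilde{\mathcal{A}}$ is a bijection. $M$-product: for $\mathcal{A}\in\mathbb{C}^{m\times n\times p}$, $\mathcal{B}\in\mathbb{C}^{n\times l\times p}$, $\mathcal{A}*_M\mathcal{B}$ is the unique $\mathcal{C}\in\mathbb{C}^{m\times l\times p}$ with $\tilde{\mathcal{C}}^{(i)}=\tilde{\mathcal{A}}^{(i)}\tilde{\mathcal{B}}^{(i)}$, $i=1,\dots,p$. The identity tensor $\mathcal{I}$ has $\tilde{\mathcal{I}}^{(i)}=I_m$ for all $i$; powers are taken with respect to $*_M$, with $\mathcal{A}^0=\mathcal{I}$.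 Tubal index of $\mathcal{A}\in\mathbb{C}^{m\times m\times p}$: $k=\max_{1\le i\le p}\mathrm{ind}(\tilde{\mathcal{A}}^{(i)})$, where $\mathrm{ind}(A)$ is the least integer $k\ge 0$ with $\mathrm{rank}(A^k)=\mathrm{rank}(A^{k+1})$. Drazin inverse: for $\mathcal{A}\in\mathbb{C}^{m\times m\times p}$ of tubal index $k$, $\mathcal{A}^{\mathrm D}$ is the unique $\mathcal{X}\in\mathbb{C}^{m\times m\times p}$ with $\mathcal{X}*_M\mathcal{A}*_M\mathcal{X}=\mathcal{X}$, $\mathcal{A}*_M\mathcal{X}=\mathcal{X}*_M\mathcal{A}$ and $\mathcal{X}*_M\mathcal{A}^{k+1}=\mathcal{A}^k$. *)

theory Defs
  imports "HOL-Analysis.Analysis"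
begin

text \<open>A tensor of size m x n x p: the entry (i, j, k) is A $ i $ j $ k.\<close>

type_synonym ('m, 'n, 'p) tensor = "complex ^ 'p ^ 'n ^ 'm"

definition mode3_transform ::
  "complex ^ 'p ^ 'p \<Rightarrow> ('m::finite, 'n::finite, 'p::finite) tensor \<Rightarrow> ('m, 'n, 'p) tensor" where
  "mode3_transform M A = (\<chi> i j k. \<Sum>s\<in>UNIV. A $ i $ j $ s * M $ k $ s)"

definition frontal_slice :: "('m::finite, 'n::finite, 'p::finite) tensor \<Rightarrow> 'p \<Rightarrow> complex ^ 'n ^ 'm" where
  "frontal_slice A k = (\<chi> i j. A $ i $ j $ k)"

abbreviation tslice ::
  "complex ^ 'p ^ 'p \<Rightarrow> ('m::finite, 'n::finite, 'p::finite) tensor \<Rightarrow> 'p \<Rightarrow> complex ^ 'n ^ 'm" where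
  "tslice M A k \<equiv> frontal_slice (mode3_transform M A) k"

text \<open>For invertible M a tensor is determined by its transformed slices, and these can be
  prescribed freely; so the definite descriptions in the product and the identity are proper.\<close>

lemma ex1_tensor_of_tslices:
  fixes M :: "complex ^ 'p::finite ^ 'p" and F :: "'p \<Rightarrow> complex ^ 'n::finite ^ 'm::finite"
  assumes "invertible M"
  shows "\<exists>!C. \<forall>k. tslice M C k = F k"
proof -
  have tslice: "(\<forall>k. tslice M C k = F k) \<longleftrightarrow> (\<forall>i j. M *v (C $ i $ j) = (\<chi> k. F k $ i $ j))" for C
    unfolding frontal_slice_def mode3_transform_def matrix_vector_mult_def vec_eq_iff
    by (auto simp: mult.commute)
  obtain N where N: "N ** M = mat 1" "M ** N = mat 1"
    using assms unfolding invertible_def by blast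
  have "M *v x = y \<longleftrightarrow> x = N *v y" for x y
    by (metis N matrix_vector_mul_assoc matrix_vector_mul_lid)
  then have "(\<forall>k. tslice M C k = F k) \<longleftrightarrow> C = (\<chi> i j. N *v (\<chi> k. F k $ i $ j))" for C
    unfolding tslice by (auto simp: vec_eq_iff[of C] vec_eq_iff[of "C $ _"])
  then show ?thesis by simp
qed

definition M_product ::
  "complex ^ 'p ^ 'p \<Rightarrow> ('m::finite, 'n::finite, 'p::finite) tensor \<Rightarrow> ('n, 'l::finite, 'p) tensor
     \<Rightarrow> ('m, 'l, 'p) tensor" where
  "M_product M A B = (THE C. \<forall>k. tslice M C k = tslice M A k ** tslice M B k)"

definition M_identity :: "complex ^ 'p ^ 'p \<Rightarrow> ('m::finite, 'm, 'p::finite) tensor" where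
  "M_identity M = (THE C. \<forall>k. tslice M C k = mat 1)"

primrec M_power ::
  "complex ^ 'p ^ 'p \<Rightarrow> ('m::finite, 'm, 'p::finite) tensor \<Rightarrow> nat \<Rightarrow> ('m, 'm, 'p) tensor" where
  "M_power M A 0 = M_identity M"
| "M_power M A (Suc r) = M_product M A (M_power M A r)"

text \<open>The operations \<open>*\<close> and \<open>^\<close> that the library provides on vector types act componentwise,
  so powers for the matrix product are needed separately.\<close>

primrec matrix_power :: "complex ^ 'm ^ 'm \<Rightarrow> nat \<Rightarrow> complex ^ 'm ^ 'm" where
  "matrix_power A 0 = mat 1"
| "matrix_power A (Suc r) = A ** matrix_power A r"

definition matrix_index :: "complex ^ 'm ^ 'm \<Rightarrow> nat" where
  "matrix_index A = (LEAST k. rank (matrix_power A k) = rank (matrix_power A (k + 1)))"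

definition tubal_index :: "complex ^ 'p ^ 'p \<Rightarrow> ('m::finite, 'm, 'p::finite) tensor \<Rightarrow> nat" where
  "tubal_index M A = Max (range (\<lambda>i. matrix_index (tslice M A i)))"

definition is_Drazin_inverse ::
  "complex ^ 'p ^ 'p \<Rightarrow> ('m::finite, 'm, 'p::finite) tensor \<Rightarrow> ('m, 'm, 'p) tensor \<Rightarrow> bool" where
  "is_Drazin_inverse M A X \<longleftrightarrow>
     M_product M (M_product M X A) X = X \<and>
     M_product M A X = M_product M X A \<and>
     M_product M X (M_power M A (tubal_index M A + 1)) = M_power M A (tubal_index M A)"

definition Drazin_inverse ::
  "complex ^ 'p ^ 'p \<Rightarrow> ('m::finite, 'm, 'p::finite) tensor \<Rightarrow> ('m, 'm, 'p) tensor" where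
  "Drazin_inverse M A = (THE X. is_Drazin_inverse M A X)"

end

theory Submission
  imports Defs
begin

text \<open>
  For invertible \<^term>\<open>M\<close> the transform turns the \<open>M\<close>-product into the ordinary product of frontal
  slices, so every assertion about tensors is an assertion about the \<open>p\<close> slices separately, with
  one complication: the power in the defining equation \<open>X A\<^sup>k\<^sup>+\<^sup>1 = A\<^sup>k\<close> is the same for all slices.
  The relation \<open>matrix_Drazin\<close> below only asks for this equation with some exponent. The
  exponent is immaterial: a matrix \<open>X\<close> that works for one exponent works for every exponent that
  is at least the index of \<open>A\<close>, hence for the tubal index
  (\<open>is_Drazin_inverse_iff_slices\<close>).

  For matrices, two facts carry the proof. Existence: equality of the ranks of \<open>A\<^sup>k\<close> and \<open>A\<^sup>k\<^sup>+\<^sup>1\<close>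
  gives \<open>A\<^sup>k = Z A\<^sup>k\<^sup>+\<^sup>1 = A\<^sup>k\<^sup>+\<^sup>1 Y\<close>, and then \<open>Z\<^sup>k\<^sup>+\<^sup>1 A\<^sup>k = A\<^sup>k Y\<^sup>k\<^sup>+\<^sup>1\<close> is a Drazin inverse.
  Commutation: a Drazin inverse \<open>D\<close> of \<open>A\<close> commutes with every \<open>B\<close> that commutes with \<open>A\<close>, because
  the idempotent \<open>P = A D\<close> equals both \<open>D\<^sup>n A\<^sup>n\<close> and \<open>A\<^sup>n D\<^sup>n\<close> for every \<open>n > 0\<close>. The second fact yields
  uniqueness, and it shows that \<open>A\<close>, \<open>B\<close> and their Drazin inverses \<open>D\<close>, \<open>E\<close> commute pairwise
  when \<open>A B = B A\<close>. In a commutative setting the three defining equations are multiplicative, so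
  \<open>E D = D E\<close> is the Drazin inverse of \<open>A B\<close>.
\<close>

section \<open>Rank and factorization of matrices\<close>

lemma matrix_vector_mult_axis:
  fixes A :: "'a::field ^ 'n::finite ^ 'm::finite"
  shows "A *v axis j 1 = column j A"
  by (simp add: vec_eq_iff matrix_vector_mult_def axis_def column_def if_distrib cong: if_cong)

lemma subspace_range_matrix:
  fixes A :: "'a::field ^ 'n::finite ^ 'm::finite"
  shows "vec.subspace (range ((*v) A))"
  using vec.linear_subspace_image[OF matrix_vector_mul_linear_gen vec.subspace_UNIV] .

lemma span_columns_eq_range:
  fixes A :: "'a::field ^ 'n::finite ^ 'm::finite"
  shows "vec.span (columns A) = range ((*v) A)"
proof
  have "columns A \<subseteq> range ((*v) A)"
    unfolding columns_def by (auto intro: rev_image_eqI[OF UNIV_I] matrix_vector_mult_axis[symmetric])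
  then show "vec.span (columns A) \<subseteq> range ((*v) A)"
    by (rule vec.span_minimal[OF _ subspace_range_matrix])
  show "range ((*v) A) \<subseteq> vec.span (columns A)"
    using matrix_vector_mult_in_columnspace_gen by blast
qed

lemma range_subset_imp_right_factor:
  fixes B :: "'a::field ^ 'n::finite ^ 'm::finite" and C :: "'a ^ 'l::finite ^ 'm"
  assumes "range ((*v) B) \<subseteq> range ((*v) C)"
  shows "\<exists>Y. B = C ** Y"
proof -
  have "\<exists>y. column j B = C *v y" for j
    using assms matrix_vector_mult_axis[of B j] by (metis imageE rangeI subsetD)
  then obtain y where y: "\<And>j. column j B = C *v y j"
    by metis
  have "B = C ** (\<chi> i j. y j $ i)"
    using y by (simp add: vec_eq_iff column_def matrix_matrix_mult_def matrix_vector_mult_def)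
  then show ?thesis ..
qed

lemma rank_eq_dim_range_transpose:
  fixes A :: "'a::field ^ 'n::finite ^ 'm::finite"
  shows "rank A = vec.dim (range ((*v) (transpose A)))"
  by (metis columns_transpose row_rank_def_gen span_columns_eq_range vec.dim_span)

lemma range_matrix_mult_subset:
  fixes A :: "'a::field ^ 'n::finite ^ 'm::finite" and B :: "'a ^ 'l::finite ^ 'n"
  shows "range ((*v) (A ** B)) \<subseteq> range ((*v) A)"
  by (auto simp flip: matrix_vector_mul_assoc)

lemma rank_mult_le_right_factor:
  fixes B :: "'a::field ^ 'n::finite ^ 'm::finite" and C :: "'a ^ 'l::finite ^ 'n"
  shows "rank (B ** C) \<le> rank C"
  by (metis matrix_transpose_mul range_matrix_mult_subset rank_eq_dim_range_transpose vec.dim_subset)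

text \<open>Equal ranks mean equal row spaces; so the rows of \<open>C\<close> are combinations of the rows of
  \<open>B C\<close>, which is a factorization on the left.\<close>

lemma rank_mult_eq_imp_left_factor:
  fixes B :: "'a::field ^ 'n::finite ^ 'm::finite" and C :: "'a ^ 'l::finite ^ 'n"
  assumes "rank (B ** C) = rank C"
  shows "\<exists>Z. C = Z ** (B ** C)"
proof -
  have "range ((*v) (transpose (B ** C))) \<subseteq> range ((*v) (transpose C))"
    by (metis matrix_transpose_mul range_matrix_mult_subset)
  then have "range ((*v) (transpose (B ** C))) = range ((*v) (transpose C))"
    using assms unfolding rank_eq_dim_range_transpose
    by (intro vec.subspace_dim_equal subspace_range_matrix) simp_all
  then obtain Y where "transpose C = transpose (B ** C) ** Y"
    using range_subset_imp_right_factor by blast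
  then have "C = transpose Y ** (B ** C)"
    by (metis matrix_transpose_mul transpose_transpose)
  then show ?thesis ..
qed

text \<open>If \<open>N = Z A N\<close>, then \<open>A\<close> is injective on the range of \<open>N\<close>; if moreover \<open>A\<close> maps this range to
  itself, then by finite dimension it maps it onto itself. This passes from a factorization on the
  left to one on the right.\<close>

lemma left_factor_imp_right_factor:
  fixes A N :: "'a::field ^ 'm::finite ^ 'm"
  assumes Z: "N = Z ** (A ** N)" and comm: "A ** N = N ** A"
  shows "\<exists>Y. N = A ** N ** Y"
proof -
  let ?S = "range ((*v) N)"
  have image: "(*v) A ` ?S = range ((*v) (A ** N))"
    by (auto simp: image_image matrix_vector_mul_assoc)
  have "N *v x = Z *v (A *v (N *v x))" for x
    using Z by (metis matrix_vector_mul_assoc)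
  then have "inj_on ((*v) A) ?S"
    by (intro inj_onI) (metis imageE)
  moreover have span: "vec.span ?S = ?S"
    unfolding vec.span_eq_iff by (rule subspace_range_matrix)
  ultimately have "vec.dim ((*v) A ` ?S) = vec.dim ?S"
    by (intro vec.dim_image_eq[OF matrix_vector_mul_linear_gen]) (simp only: span)
  moreover have "(*v) A ` ?S \<subseteq> ?S"
    unfolding image comm by (rule range_matrix_mult_subset)
  ultimately have "(*v) A ` ?S = ?S"
    unfolding image by (intro vec.subspace_dim_equal subspace_range_matrix) simp_all
  then show ?thesis
    unfolding image by (intro range_subset_imp_right_factor) simp
qed

section \<open>Powers and the index of a matrix\<close>

lemma matrix_power_add: "matrix_power A (m + n) = matrix_power A m ** matrix_power A n"
  by (induction m) (simp_all add: matrix_mul_assoc)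

lemma matrix_power_commute:
  assumes "A ** B = B ** A"
  shows "matrix_power A n ** B = B ** matrix_power A n"
  by (induction n) (simp, metis assms matrix_mul_assoc matrix_power.simps(2))

lemma matrix_power_Suc_right: "matrix_power A (Suc n) = matrix_power A n ** A"
  by (simp add: matrix_power_commute)

lemma matrix_power_mult:
  assumes "A ** B = B ** A"
  shows "matrix_power (A ** B) n = matrix_power A n ** matrix_power B n"
proof (induction n)
  case (Suc n)
  have "A ** B ** (matrix_power A n ** matrix_power B n)
      = A ** (matrix_power A n ** B) ** matrix_power B n"
    by (metis assms matrix_mul_assoc matrix_power_commute)
  with Suc show ?case
    by (simp add: matrix_mul_assoc)
qed simp

text \<open>The ranks of the powers cannot decrease forever, so the minimum that defines the index is
  attained.\<close>

lemma rank_matrix_power_index: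
  "rank (matrix_power A (Suc (matrix_index A))) = rank (matrix_power A (matrix_index A))"
proof -
  have "\<exists>k. rank (matrix_power A k) = rank (matrix_power A (k + 1))"
  proof (rule ccontr)
    assume "\<nexists>k. rank (matrix_power A k) = rank (matrix_power A (k + 1))"
    then have "rank (matrix_power A (Suc k)) \<noteq> rank (matrix_power A k)" for k
      by (metis Suc_eq_plus1)
    moreover have "rank (matrix_power A (Suc k)) \<le> rank (matrix_power A k)" for k
      by (simp add: rank_mult_le_right_factor)
    ultimately have less: "rank (matrix_power A (Suc k)) < rank (matrix_power A k)" for k
      by (simp add: order.strict_iff_order)
    have "rank (matrix_power A k) + k \<le> rank (matrix_power A 0)" for k
    proof (induction k)
      case (Suc k)
      with less[of k] show ?case by linarith
    qed simp
    from this[of "Suc (rank (matrix_power A 0))"] show False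
      by simp
  qed
  then show ?thesis
    unfolding matrix_index_def Suc_eq_plus1 by (rule LeastI_ex[THEN sym])
qed

lemma matrix_power_left_absorb:
  assumes "matrix_power A k = Z ** matrix_power A (Suc k)"
  shows "matrix_power A k = matrix_power Z j ** matrix_power A (k + j)"
proof (induction j)
  case (Suc j)
  have "matrix_power A (k + j) = Z ** matrix_power A (k + Suc j)"
    by (metis add_Suc add_Suc_right assms matrix_mul_assoc matrix_power_add)
  with Suc show ?case
    by (metis matrix_mul_assoc matrix_power_Suc_right)
qed simp

lemma matrix_power_right_absorb:
  assumes "matrix_power A k = matrix_power A (Suc k) ** Y"
  shows "matrix_power A k = matrix_power A (k + j) ** matrix_power Y j"
proof (induction j)
  case (Suc j)
  have "matrix_power A (k + j) = matrix_power A (k + Suc j) ** Y"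
    by (metis add.commute add_Suc add_Suc_right assms matrix_mul_assoc matrix_power_add)
  with Suc show ?case
    by (metis matrix_mul_assoc matrix_power.simps(2))
qed simp

section \<open>The Drazin inverse of a matrix\<close>

text \<open>The exponent is existentially quantified, rather than fixed as the index of \<open>A\<close>, so that
  the relation can be applied to slices whose indices differ from the tubal index.\<close>

definition matrix_Drazin :: "complex ^ 'm::finite ^ 'm \<Rightarrow> complex ^ 'm ^ 'm \<Rightarrow> bool" where
  "matrix_Drazin A X \<longleftrightarrow> X ** A ** X = X \<and> A ** X = X ** A \<and>
     (\<exists>k. X ** matrix_power A (Suc k) = matrix_power A k)"

lemma Drazin_equation_mono:
  assumes "X ** matrix_power A (Suc k) = matrix_power A k" and "k \<le> n"
  shows "X ** matrix_power A (Suc n) = matrix_power A n"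
proof -
  obtain j where n: "n = k + j"
    using assms(2) le_Suc_ex by blast
  show ?thesis
    using assms(1) matrix_power_add[of A "Suc k" j] matrix_power_add[of A k j]
    by (simp add: n matrix_mul_assoc)
qed

text \<open>At the index \<open>k\<close> the factorizations \<open>A\<^sup>k = Z A\<^sup>k\<^sup>+\<^sup>1 = A\<^sup>k\<^sup>+\<^sup>1 Y\<close> make \<open>D = Z\<^sup>k\<^sup>+\<^sup>1 A\<^sup>k\<close> equal to
  \<open>A\<^sup>k Y\<^sup>k\<^sup>+\<^sup>1\<close>. The first expression gives \<open>D A = Z\<^sup>k A\<^sup>k\<close>, the second \<open>A D = A\<^sup>k Y\<^sup>k\<close>, and these agree
  because both equal \<open>Z\<^sup>k A\<^sup>2\<^sup>k Y\<^sup>k\<close>.\<close>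

lemma matrix_Drazin_exists:
  "\<exists>X. matrix_Drazin A X \<and>
     X ** matrix_power A (Suc (matrix_index A)) = matrix_power A (matrix_index A)"
proof -
  define k where "k = matrix_index A"
  obtain Z where Z: "matrix_power A k = Z ** matrix_power A (Suc k)"
    using rank_mult_eq_imp_left_factor[of A "matrix_power A k"] rank_matrix_power_index[of A]
    by (auto simp: k_def)
  moreover have "A ** matrix_power A k = matrix_power A k ** A"
    using matrix_power_Suc_right by simp
  ultimately have "\<exists>Y. matrix_power A k = A ** matrix_power A k ** Y"
    by (intro left_factor_imp_right_factor[where Z = Z]) (simp_all only: matrix_power.simps)
  then obtain Y where Y: "matrix_power A k = matrix_power A (Suc k) ** Y"
    by auto
  note left = matrix_power_left_absorb[OF Z, symmetric]
    and right = matrix_power_right_absorb[OF Y, symmetric]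
  define D where "D = matrix_power Z (Suc k) ** matrix_power A k"
  have "D = matrix_power Z (Suc k) ** (matrix_power A (k + Suc k) ** matrix_power Y (Suc k))"
    by (simp only: D_def right)
  then have D_right: "D = matrix_power A k ** matrix_power Y (Suc k)"
    by (simp only: matrix_mul_assoc left)
  have "matrix_power Z k ** matrix_power A k
      = matrix_power Z k ** (matrix_power A (k + k) ** matrix_power Y k)"
    by (simp only: right)
  then have agree: "matrix_power Z k ** matrix_power A k = matrix_power A k ** matrix_power Y k"
    by (simp only: matrix_mul_assoc left)
  have "D ** A = matrix_power Z k ** (Z ** matrix_power A (Suc k))"
    unfolding D_def matrix_power_Suc_right by (simp only: matrix_mul_assoc)
  then have DA: "D ** A = matrix_power Z k ** matrix_power A k"
    by (simp only: Z[symmetric])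
  have "A ** D = (matrix_power A (Suc k) ** Y) ** matrix_power Y k"
    unfolding D_right by (simp only: matrix_power.simps matrix_mul_assoc)
  then have AD: "A ** D = matrix_power A k ** matrix_power Y k"
    by (simp only: Y[symmetric])
  have "D ** matrix_power A (Suc k) = matrix_power Z (Suc k) ** matrix_power A (k + Suc k)"
    by (simp only: D_def matrix_power_add matrix_mul_assoc)
  then have eq: "D ** matrix_power A (Suc k) = matrix_power A k"
    by (simp only: left)
  have "D ** A ** D = matrix_power Z k ** matrix_power A (k + k) ** matrix_power Y (Suc k)"
    unfolding DA by (simp only: D_right matrix_power_add matrix_mul_assoc)
  also have "\<dots> = D"
    by (simp only: left D_right)
  finally have "D ** A ** D = D" .
  then have "matrix_Drazin A D"
    unfolding matrix_Drazin_def using DA AD agree eq by auto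
  then show ?thesis
    using eq k_def by blast
qed

text \<open>Commutation with \<open>B\<close> is first shown for the idempotent \<open>P = A D\<close>. For large \<open>n\<close> one has
  \<open>A\<^sup>n P = A\<^sup>n = P A\<^sup>n\<close>, so moving \<open>B\<close> through the power \<open>A\<^sup>n\<close> inside \<open>P\<close> shows that \<open>P B\<close> and \<open>B P\<close>
  both equal \<open>P B P\<close>.\<close>

lemma matrix_Drazin_commute:
  assumes D: "matrix_Drazin A D" and comm: "A ** B = B ** A"
  shows "D ** B = B ** D"
proof -
  obtain k where k: "D ** matrix_power A (Suc k) = matrix_power A k"
    using D unfolding matrix_Drazin_def by blast
  have DAD: "D ** A ** D = D" and AD: "A ** D = D ** A"
    using D unfolding matrix_Drazin_def by auto
  define n where "n = Suc k"
  define P N Q where "P = A ** D" and "N = matrix_power A n" and "Q = matrix_power D n"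
  have "matrix_power D (Suc j) ** matrix_power A (Suc j) = P" for j
  proof (induction j)
    case 0
    then show ?case by (simp add: P_def AD)
  next
    case (Suc j)
    have "matrix_power D (Suc (Suc j)) ** matrix_power A (Suc (Suc j))
        = D ** (matrix_power D (Suc j) ** matrix_power A (Suc j)) ** A"
      by (metis matrix_mul_assoc matrix_power.simps(2) matrix_power_Suc_right)
    also have "\<dots> = D ** A ** D ** A"
      by (simp only: Suc P_def matrix_mul_assoc)
    finally show ?case
      by (simp add: DAD P_def AD)
  qed
  then have QN: "Q ** N = P"
    by (simp add: Q_def N_def n_def)
  have "N ** D = D ** N"
    unfolding N_def by (rule matrix_power_commute[OF AD])
  then have NQ: "N ** Q = P"
    unfolding Q_def using QN matrix_power_commute[of D N n] by (simp add: Q_def)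
  have "D ** matrix_power A (Suc n) = N"
    unfolding N_def by (rule Drazin_equation_mono[OF k]) (simp add: n_def)
  then have PN: "P ** N = N"
    by (simp add: P_def N_def AD matrix_mul_assoc)
  have NP: "N ** P = N"
    using PN NQ QN by (metis matrix_mul_assoc)
  have NB: "N ** B = B ** N"
    unfolding N_def by (rule matrix_power_commute[OF comm])
  have PB1: "P ** B = Q ** (B ** N)"
    by (simp only: QN[symmetric] NB[symmetric] matrix_mul_assoc[symmetric])
  also have "\<dots> = Q ** (B ** N) ** P"
    by (simp only: NP matrix_mul_assoc[symmetric])
  finally have "P ** B = P ** B ** P"
    by (simp only: PB1)
  moreover have BP1: "B ** P = N ** B ** Q"
    by (simp only: NQ[symmetric] NB matrix_mul_assoc)
  have "\<dots> = P ** (N ** B ** Q)"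
    by (simp only: PN matrix_mul_assoc)
  then have "B ** P = P ** B ** P"
    by (simp only: BP1 matrix_mul_assoc[symmetric])
  ultimately have PB: "P ** B = B ** P"
    by simp
  have DP: "D ** P = D"
    using DAD by (simp only: P_def matrix_mul_assoc)
  have PD: "P ** D = D"
    using DAD by (simp only: P_def AD)
  have "D ** B = D ** (P ** B)"
    by (simp only: DP matrix_mul_assoc)
  also have "\<dots> = D ** (B ** A) ** D"
    by (simp only: PB) (simp only: P_def matrix_mul_assoc)
  also have "\<dots> = P ** B ** D"
    by (simp only: comm[symmetric] P_def AD matrix_mul_assoc)
  also have "\<dots> = B ** (P ** D)"
    by (simp only: PB matrix_mul_assoc)
  also have "\<dots> = B ** D"
    by (simp only: PD)
  finally show ?thesis .
qed

text \<open>Since \<open>Y = A\<^sup>n Y\<^sup>n\<^sup>+\<^sup>1\<close> for every \<open>n\<close> and \<open>X A\<^sup>n\<^sup>+\<^sup>1 = A\<^sup>n\<close> for some \<open>n\<close>, one has \<open>X A Y = Y\<close>. By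
  symmetry \<open>Y A X = X\<close>, and the two left sides agree because \<open>A\<close>, \<open>X\<close>, \<open>Y\<close> commute.\<close>

lemma matrix_Drazin_unique:
  assumes X: "matrix_Drazin A X" and Y: "matrix_Drazin A Y"
  shows "X = Y"
proof -
  have absorb: "U ** A ** V = V" if U: "matrix_Drazin A U" and V: "matrix_Drazin A V" for U V
  proof -
    have V1: "V ** A ** V = V" and AV: "A ** V = V ** A"
      using V unfolding matrix_Drazin_def by auto
    obtain k where k: "U ** matrix_power A (Suc k) = matrix_power A k"
      using U unfolding matrix_Drazin_def by blast
    have power: "V = matrix_power A j ** matrix_power V (Suc j)" for j
    proof (induction j)
      case (Suc j)
      have "A ** V ** V = V"
        using V1 AV by metis
      moreover have "matrix_power A (Suc j) ** matrix_power V (Suc (Suc j))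
          = matrix_power A j ** (A ** V ** V) ** matrix_power V j"
        by (metis matrix_mul_assoc matrix_power.simps(2) matrix_power_Suc_right)
      ultimately show ?case
        using Suc by (metis matrix_mul_assoc matrix_power.simps(2))
    qed simp
    have "U ** A ** V = U ** matrix_power A (Suc k) ** matrix_power V (Suc k)"
      using power[of k] by (metis matrix_mul_assoc matrix_power.simps(2))
    then show ?thesis
      using k power[of k] by simp
  qed
  have AX: "A ** X = X ** A" and AY: "A ** Y = Y ** A"
    using X Y unfolding matrix_Drazin_def by auto
  have "Y ** X = X ** Y"
    by (rule matrix_Drazin_commute[OF Y AX])
  then have "X ** A ** Y = Y ** A ** X"
    using AX AY by (metis matrix_mul_assoc)
  then show ?thesis
    using absorb[OF X Y] absorb[OF Y X] by simp
qed

lemma Drazin_equation_ge_index: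
  assumes "matrix_Drazin A X" and "matrix_index A \<le> n"
  shows "X ** matrix_power A (Suc n) = matrix_power A n"
  using assms matrix_Drazin_exists[of A] Drazin_equation_mono matrix_Drazin_unique by metis

lemma matrix_Drazin_mult:
  assumes D: "matrix_Drazin A D" and E: "matrix_Drazin B E" and AB: "A ** B = B ** A"
  shows "matrix_Drazin (A ** B) (E ** D)" and "E ** D = D ** E"
proof -
  have DB: "D ** B = B ** D"
    by (rule matrix_Drazin_commute[OF D AB])
  have EA: "E ** A = A ** E"
    by (rule matrix_Drazin_commute[OF E AB[symmetric]])
  show ED: "E ** D = D ** E"
    by (rule matrix_Drazin_commute[OF E DB[symmetric]])
  have D1: "D ** A ** D = D" and AD: "A ** D = D ** A"
    and E1: "E ** B ** E = E" and BE: "B ** E = E ** B"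
    using D E unfolding matrix_Drazin_def by auto
  obtain k l where "D ** matrix_power A (Suc k) = matrix_power A k"
    and "E ** matrix_power B (Suc l) = matrix_power B l"
    using D E unfolding matrix_Drazin_def by blast
  then have k: "D ** matrix_power A (Suc (max k l)) = matrix_power A (max k l)"
    and l: "E ** matrix_power B (Suc (max k l)) = matrix_power B (max k l)"
    using Drazin_equation_mono by (metis max.cobounded1, metis max.cobounded2)
  have regroup: "E ** D ** (A ** B) = (E ** B) ** (D ** A)"
    by (metis AB DB matrix_mul_assoc)
  have "E ** D ** (A ** B) ** (E ** D) = (E ** B ** E) ** (D ** A ** D)"
    unfolding regroup by (metis EA ED matrix_mul_assoc)
  then have "E ** D ** (A ** B) ** (E ** D) = E ** D"
    by (simp add: D1 E1)
  moreover have "A ** B ** (E ** D) = E ** D ** (A ** B)"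
    by (metis AB AD BE DB EA matrix_mul_assoc)
  moreover have "E ** D ** matrix_power (A ** B) (Suc (max k l)) = matrix_power (A ** B) (max k l)"
  proof -
    let ?n = "max k l"
    have "E ** matrix_power A ?n = matrix_power A ?n ** E"
      using matrix_power_commute EA by metis
    then show ?thesis
      unfolding matrix_power_mult[OF AB] by (metis k l matrix_mul_assoc)
  qed
  ultimately show "matrix_Drazin (A ** B) (E ** D)"
    unfolding matrix_Drazin_def by blast
qed

section \<open>Reduction of tensors to their transformed slices\<close>

lemma tslice_M_product:
  assumes "invertible M"
  shows "tslice M (M_product M A B) i = tslice M A i ** tslice M B i"
  unfolding M_product_def
  using theI'[OF ex1_tensor_of_tslices[OF assms, of "\<lambda>i. tslice M A i ** tslice M B i"]] by blast

lemma tslice_M_power: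
  fixes A :: "('m::finite, 'm, 'p::finite) tensor"
  assumes "invertible M"
  shows "tslice M (M_power M A n) i = matrix_power (tslice M A i) n"
proof (induction n)
  case 0
  show ?case
    using theI'[OF ex1_tensor_of_tslices[OF assms, of "\<lambda>i. mat 1 :: complex ^ 'm ^ 'm"]]
    by (simp add: M_identity_def)
qed (simp add: tslice_M_product[OF assms])

lemma tensor_eq_iff_tslice:
  assumes "invertible M"
  shows "A = B \<longleftrightarrow> (\<forall>i. tslice M A i = tslice M B i)"
  using ex1_tensor_of_tslices[OF assms, of "tslice M B"] by blast

lemma is_Drazin_inverse_iff_slices:
  assumes M: "invertible M"
  shows "is_Drazin_inverse M A X \<longleftrightarrow> (\<forall>i. matrix_Drazin (tslice M A i) (tslice M X i))"
proof -
  have "matrix_index (tslice M A i) \<le> tubal_index M A" for i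
    unfolding tubal_index_def by (rule Max_ge) auto
  then have "matrix_Drazin (tslice M A i) (tslice M X i) \<longleftrightarrow>
      tslice M X i ** tslice M A i ** tslice M X i = tslice M X i \<and>
      tslice M A i ** tslice M X i = tslice M X i ** tslice M A i \<and>
      tslice M X i ** matrix_power (tslice M A i) (Suc (tubal_index M A))
        = matrix_power (tslice M A i) (tubal_index M A)" for i
    using Drazin_equation_ge_index unfolding matrix_Drazin_def by blast
  then show ?thesis
    unfolding is_Drazin_inverse_def tensor_eq_iff_tslice[OF M] tslice_M_product[OF M]
      tslice_M_power[OF M] Suc_eq_plus1 by blast
qed

lemma ex1_is_Drazin_inverse:
  assumes M: "invertible M"
  shows "\<exists>!X. is_Drazin_inverse M A X"
proof -
  have "\<forall>i. \<exists>F. matrix_Drazin (tslice M A i) F"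
    using matrix_Drazin_exists by blast
  then obtain F where F: "\<And>i. matrix_Drazin (tslice M A i) (F i)"
    by metis
  obtain X where "\<And>i. tslice M X i = F i"
    using ex1_tensor_of_tslices[OF M, of F] by blast
  with F have "is_Drazin_inverse M A X"
    by (simp add: is_Drazin_inverse_iff_slices[OF M])
  moreover have "X' = X''" if "is_Drazin_inverse M A X'" "is_Drazin_inverse M A X''" for X' X''
    using that matrix_Drazin_unique
    unfolding is_Drazin_inverse_iff_slices[OF M] tensor_eq_iff_tslice[OF M] by blast
  ultimately show ?thesis
    by blast
qed

lemma matrix_Drazin_tslice_Drazin_inverse:
  assumes "invertible M"
  shows "matrix_Drazin (tslice M A i) (tslice M (Drazin_inverse M A) i)"
  using theI'[OF ex1_is_Drazin_inverse[OF assms]]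
  unfolding Drazin_inverse_def is_Drazin_inverse_iff_slices[OF assms] by blast

section \<open>The Drazin inverse of a product of commuting tensors\<close>

theorem theorem3p11:
  fixes M :: "complex ^ 'p::finite ^ 'p"
    and A B :: "('m::finite, 'm, 'p) tensor"
    and k1 k2 :: nat
  assumes "invertible M"
    and "tubal_index M A = k1" and "tubal_index M B = k2"
    and "M_product M A B = M_product M B A"
  shows "Drazin_inverse M (M_product M A B) = M_product M (Drazin_inverse M B) (Drazin_inverse M A)
    \<and> M_product M (Drazin_inverse M B) (Drazin_inverse M A)
        = M_product M (Drazin_inverse M A) (Drazin_inverse M B)"
proof -
  note M = assms(1)
  let ?D = "Drazin_inverse M A" and ?E = "Drazin_inverse M B"
  have "tslice M A i ** tslice M B i = tslice M B i ** tslice M A i" for i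
    using assms(4) by (metis tslice_M_product[OF M])
  note mult = matrix_Drazin_mult[OF matrix_Drazin_tslice_Drazin_inverse[OF M]
      matrix_Drazin_tslice_Drazin_inverse[OF M] this]
  have "is_Drazin_inverse M (M_product M A B) (M_product M ?E ?D)"
    unfolding is_Drazin_inverse_iff_slices[OF M] tslice_M_product[OF M] using mult(1) by blast
  then have "Drazin_inverse M (M_product M A B) = M_product M ?E ?D"
    unfolding Drazin_inverse_def by (rule the1_equality[OF ex1_is_Drazin_inverse[OF M]])
  moreover have "M_product M ?E ?D = M_product M ?D ?E"
    unfolding tensor_eq_iff_tslice[OF M] tslice_M_product[OF M] using mult(2) by blast
  ultimately show ?thesis
    by blast
qed

end
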